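(* Let $X$ be a complete L-ordered metric space and let $p,q\in PX$. Then $p\le q$ in the stochastic order if and only if for every short monotone map $f:X\to\mathbb{R}$, $$\int f\,dp\le\int f\,dq.$$
   Context: An ordered metric space is a metric space $X$ equipped with a partial order $\le$ whose graph $\{\le\}=\{(x,y): x\le y\}\subseteq X\times X$ is closed. A map between metric spaces is short if it is 1-Lipschitz. An ordered metric space $X$ is L-ordered if for all $x,y\in X$: $x\le y$ if and only if $f(x)\le f(y)$ for every short monotone function $f:X\to\mathbb{R}$ ($\mathbb{R}$ with its usual metric and order). $PX$ is the set of Radon probability measures $p$ on $X$ of finite first moment, i.e. such that $\int f\,dp$ exists and is finite for every short $f:X\to\mathbb{R}$. A coupling of $p$ and $q$ is a probability measure on $X\times X$ whose first and second marginals are $p$ and $q$. Stochastic order: for $p,q\in PX$, $p\le q$ if and only if there is a coupling $r$ of $p$ and $q$ supported on the closed set $\{\le\}$ (i.e. the complement of $\{\le\}$ has $r$-measure zero). *)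

theory Defs
  imports "HOL-Probability.Probability"
begin

definition short :: "('a::metric_space \<Rightarrow> 'b::metric_space) \<Rightarrow> bool" where
  "short f \<longleftrightarrow> 1-lipschitz_on UNIV f"

text \<open>
  Metric and partial order are those of the type classes; what ties them together is stated as a
  predicate on the type, since a class assumption cannot refer directly to the topology of the
  product type.
\<close>

definition ordered_metric_space :: "'a::{metric_space, order} itself \<Rightarrow> bool" where
  "ordered_metric_space T \<longleftrightarrow> closed {(x :: 'a, y). x \<le> y}"

definition L_ordered_metric_space :: "'a::{metric_space, order} itself \<Rightarrow> bool" where
  "L_ordered_metric_space T \<longleftrightarrow> ordered_metric_space T \<and>
     (\<forall>x y :: 'a. x \<le> y \<longleftrightarrow> (\<forall>f :: 'a \<Rightarrow> real. short f \<and> mono f \<longrightarrow> f x \<le> f y))"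

definition radon_prob :: "'a::metric_space measure \<Rightarrow> bool" where
  "radon_prob p \<longleftrightarrow> prob_space p \<and> sets p = sets borel \<and>
     (\<forall>A \<in> sets borel. emeasure p A = (SUP K \<in> {K. compact K \<and> K \<subseteq> A}. emeasure p K))"

definition finite_moment_measures :: "'a::metric_space measure set" where
  "finite_moment_measures = {p. radon_prob p \<and> (\<forall>f :: 'a \<Rightarrow> real. short f \<longrightarrow> integrable p f)}"

text \<open>
  Couplings live on the Borel \<open>\<sigma>\<close>-algebra of the product space. Without separability it can be
  strictly larger than the product \<open>\<sigma>\<close>-algebra \<open>borel \<Otimes>\<^sub>M borel\<close>, and the graph of the order,
  being closed, need only belong to the former.
\<close>

definition coupling :: "('a::metric_space \<times> 'a) measure \<Rightarrow> 'a measure \<Rightarrow> 'a measure \<Rightarrow> bool" where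
  "coupling r p q \<longleftrightarrow> prob_space r \<and> sets r = sets borel \<and>
     distr r borel fst = p \<and> distr r borel snd = q"

definition stochastic_le :: "'a::{metric_space, order} measure \<Rightarrow> 'a measure \<Rightarrow> bool" where
  "stochastic_le p q \<longleftrightarrow> (\<exists>r. coupling r p q \<and> emeasure r (- {(x, y). x \<le> y}) = 0)"

end

(*
For K compact, the distance phi(y) = inf_{x in K} sup_f (f x - f y), with f ranging over the short
monotone functions, is short and antitone and vanishes exactly on the up-closure of K. Testing
with max(0, 1/n - phi) gives p(K) <= q(up-closure of K), hence by inner regularity p(A) <= q(B)
whenever the Borel set B contains the up-closure of the Borel set A. For finitely many Borel sets
this is the Hall condition of a transport problem between their atoms; a solution is a finitely
supported measure on the graph of the order with the prescribed marginals on these sets.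
By Tychonoff's theorem there is then a finitely additive probability on all subsets of X x X,
concentrated on the graph of the order, whose marginals are p and q on all Borel sets. Since p and
q are Radon, it is countably additive on Borel rectangles, so Caratheodory's theorem yields
a measure, and the complement of the graph is, up to a null set, a countable union of null
rectangles.
*)

theory Submission
  imports Defs
begin

subsection \<open>Transport plans on finite sets\<close>

text \<open>Columns are only bounded by \<open>b\<close>, so a Hall condition on sets of sources
  suffices and the totals of subproblems need not balance; equality is recovered later, when both
  totals agree. Plans vanish off \<open>S \<times> T\<close>, so that plans on disjoint blocks can
  be added.\<close>

definition transport_plan ::
  "('s \<times> 't) set \<Rightarrow> 's set \<Rightarrow> 't set \<Rightarrow> ('s \<Rightarrow> real) \<Rightarrow> ('t \<Rightarrow> real) \<Rightarrow> ('s \<Rightarrow> 't \<Rightarrow> real) \<Rightarrow> bool" where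
  "transport_plan E S T a b w \<longleftrightarrow>
     (\<forall>s t. 0 \<le> w s t) \<and> (\<forall>s t. w s t \<noteq> 0 \<longrightarrow> s \<in> S \<and> t \<in> T \<and> (s, t) \<in> E) \<and>
     (\<forall>s\<in>S. (\<Sum>t\<in>T. w s t) = a s) \<and> (\<forall>t\<in>T. (\<Sum>s\<in>S. w s t) \<le> b t)"

lemma transport_plan_row_mono:
  assumes "transport_plan E S T a b w" "T \<subseteq> T'" "finite T'"
  shows "(\<Sum>t\<in>T'. w s t) = (\<Sum>t\<in>T. w s t)"
  using assms unfolding transport_plan_def by (intro sum.mono_neutral_right) auto

lemma transport_plan_col_mono:
  assumes "transport_plan E S T a b w" "S \<subseteq> S'" "finite S'"
  shows "(\<Sum>s\<in>S'. w s t) = (\<Sum>s\<in>S. w s t)"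
  using assms unfolding transport_plan_def by (intro sum.mono_neutral_right) auto

lemma transport_plan_outside:
  assumes "transport_plan E S T a b w" "s \<notin> S \<or> t \<notin> T"
  shows "w s t = 0"
  using assms unfolding transport_plan_def by blast

text \<open>Each element of \<open>S\<close> lies in exactly one of \<open>I\<close> and
  \<open>S - I\<close>, each element of \<open>T\<close> in exactly one of \<open>J\<close> and
  \<open>T - J\<close>, and both plans vanish off their own blocks. Hence every row or column sum of
  the total comes from a single plan.\<close>

lemma transport_plan_sum:
  assumes w: "transport_plan E I J a b w" and v: "transport_plan E (S - I) (T - J) a b v"
    and "I \<subseteq> S" "J \<subseteq> T" and fin: "finite S" "finite T"
  shows "transport_plan E S T a b (\<lambda>s t. w s t + v s t)"
proof -
  have row: "(\<Sum>t\<in>T. w s t + v s t) = a s" if "s \<in> S" for s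
  proof (cases "s \<in> I")
    case True
    then show ?thesis
      using transport_plan_row_mono[OF w \<open>J \<subseteq> T\<close> fin(2)] transport_plan_outside[OF v, of s] w
      by (simp add: sum.distrib transport_plan_def)
  next
    case False
    then show ?thesis
      using transport_plan_row_mono[OF v _ fin(2)] transport_plan_outside[OF w, of s] v that
      by (simp add: sum.distrib transport_plan_def)
  qed
  have col: "(\<Sum>s\<in>S. w s t + v s t) \<le> b t" if "t \<in> T" for t
  proof (cases "t \<in> J")
    case True
    then show ?thesis
      using transport_plan_col_mono[OF w \<open>I \<subseteq> S\<close> fin(1)] transport_plan_outside[OF v, of _ t] w
      by (simp add: sum.distrib transport_plan_def)
  next
    case False
    then show ?thesis
      using transport_plan_col_mono[OF v _ fin(1)] transport_plan_outside[OF w, of _ t] v that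
      by (simp add: sum.distrib transport_plan_def)
  qed
  have "s \<in> S \<and> t \<in> T \<and> (s, t) \<in> E" if "w s t + v s t \<noteq> 0" for s t
  proof -
    from that have "w s t \<noteq> 0 \<or> v s t \<noteq> 0" by auto
    then show ?thesis
      using w v \<open>I \<subseteq> S\<close> \<open>J \<subseteq> T\<close> unfolding transport_plan_def by blast
  qed
  then show ?thesis
    using row col w v unfolding transport_plan_def by auto
qed

lemma transport_plan_extend:
  assumes w: "transport_plan E I J a b w" and "I \<subseteq> S" "J \<subseteq> T" and "finite S" "finite T"
    and "\<And>s. s \<in> S - I \<Longrightarrow> a s = 0" "\<And>t. t \<in> T - J \<Longrightarrow> 0 \<le> b t"
  shows "transport_plan E S T a b w"
proof -
  have "transport_plan E (S - I) (T - J) a b (\<lambda>_ _. 0)"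
    using assms by (auto simp: transport_plan_def)
  from transport_plan_sum[OF w this] show ?thesis
    using assms by simp
qed

text \<open>Undoes the reduction made in the induction below: once the residual problem is solved,
  the amount \<open>e\<close> set aside for the edge from \<open>s0\<close> to \<open>t0\<close> is
  put back.\<close>

lemma transport_plan_add_edge:
  assumes w: "transport_plan E S T (a(s0 := a s0 - e)) (b(t0 := b t0 - e)) w"
    and "s0 \<in> S" "t0 \<in> T" "(s0, t0) \<in> E" "0 \<le> e" "finite S" "finite T"
  shows "transport_plan E S T a b (\<lambda>s t. w s t + (if s = s0 \<and> t = t0 then e else 0))"
proof -
  have row: "(\<Sum>t\<in>T. if s = s0 \<and> t = t0 then e else 0) = (if s = s0 then e else 0)" for s
    using assms by (cases "s = s0") auto
  have col: "(\<Sum>s\<in>S. if s = s0 \<and> t = t0 then e else 0) = (if t = t0 then e else 0)" for t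
    using assms by (cases "t = t0") auto
  have rw: "(\<Sum>t\<in>T. w s t) = (if s = s0 then a s0 - e else a s)" if "s \<in> S" for s
    using w that by (auto simp: transport_plan_def)
  have cw: "(\<Sum>s\<in>S. w s t) \<le> (if t = t0 then b t0 - e else b t)" if "t \<in> T" for t
    using w that by (auto simp: transport_plan_def)
  have "(\<Sum>t\<in>T. w s t + (if s = s0 \<and> t = t0 then e else 0)) = a s" if "s \<in> S" for s
    using rw[OF that] row[of s] by (auto simp: sum.distrib split: if_splits)
  moreover have "(\<Sum>s\<in>S. w s t + (if s = s0 \<and> t = t0 then e else 0)) \<le> b t" if "t \<in> T" for t
    using cw[OF that] col[of t] by (auto simp: sum.distrib split: if_splits)
  ultimately show ?thesis
    using w assms unfolding transport_plan_def by auto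
qed

lemma sum_fun_upd_diff:
  fixes a :: "'s \<Rightarrow> real"
  assumes "finite I"
  shows "sum (a(s := a s - e)) I = sum a I - (if s \<in> I then e else 0)"
proof (cases "s \<in> I")
  case True
  then show ?thesis using assms by (simp add: sum.remove[of I s])
next
  case False
  then have "sum (a(s := a s - e)) I = sum a I"
    by (intro sum.cong) auto
  with False show ?thesis by simp
qed

text \<open>
  Ship along an edge as much as the Hall condition permits. Then the source or the target of the
  edge is exhausted, or a set of sources has become tight and splits the problem in two.
\<close>

lemma transport_plan_exists:
  fixes a :: "'s \<Rightarrow> real" and b :: "'t \<Rightarrow> real"
  assumes "finite S" "finite T"
    and "\<And>s. s \<in> S \<Longrightarrow> 0 \<le> a s" "\<And>t. t \<in> T \<Longrightarrow> 0 \<le> b t"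
    and "\<And>I. I \<subseteq> S \<Longrightarrow> sum a I \<le> sum b (T \<inter> E `` I)"
  shows "\<exists>w. transport_plan E S T a b w"
  using assms
proof (induction "card S + card T" arbitrary: S T a b rule: less_induct)
  case less
  note fin = less.prems(1,2) and hall = less.prems(5)
  show ?case
  proof (cases "\<forall>s\<in>S. a s = 0")
    case True
    then have "transport_plan E S T a b (\<lambda>_ _. 0)"
      using less.prems by (auto simp: transport_plan_def)
    then show ?thesis by blast
  next
    case False
    then obtain s where s: "s \<in> S" "0 < a s"
      using less.prems(3) by (metis less_eq_real_def)
    have "0 < sum b (T \<inter> E `` {s})"
      using hall[of "{s}"] s by auto
    then have "\<not> (\<forall>t \<in> T \<inter> E `` {s}. b t \<le> 0)"
      by (meson not_le sum_nonpos)
    then obtain t where t: "t \<in> T" "(s, t) \<in> E" "0 < b t"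
      by auto
    \<comment> \<open>These are the sets whose Hall inequality loses slack when \<open>e\<close> is
      shipped from \<open>s\<close> to \<open>t\<close>. If \<open>s \<in> I\<close>, then
      \<open>I\<close> also reaches \<open>t\<close> and both sides drop by \<open>e\<close>; if
      \<open>I\<close> contains neither \<open>s\<close> nor a neighbour of \<open>t\<close>,
      nothing changes. The minimum of \<open>V\<close> is the largest amount that keeps all
      inequalities and nonnegativity.\<close>
    define \<I> where "\<I> = {I. I \<subseteq> S \<and> s \<notin> I \<and> t \<in> E `` I}"
    define V where "V = {a s, b t} \<union> (\<lambda>I. sum b (T \<inter> E `` I) - sum a I) ` \<I>"
    define e where "e = Min V"
    define a' where "a' = a(s := a s - e)"
    define b' where "b' = b(t := b t - e)"
    have "finite \<I>"
      unfolding \<I>_def using fin by auto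
    then have "finite V" "V \<noteq> {}"
      by (auto simp: V_def)
    then have eV: "e \<in> V" and e_le: "\<And>v. v \<in> V \<Longrightarrow> e \<le> v"
      by (auto simp: e_def)
    have "0 \<le> e"
      using eV s t hall by (auto simp: V_def \<I>_def)
    have e_as: "e \<le> a s" and e_bt: "e \<le> b t"
      using e_le by (auto simp: V_def)
    have suma: "sum a' I = sum a I - (if s \<in> I then e else 0)" if "I \<subseteq> S" for I
      unfolding a'_def using finite_subset[OF that fin(1)] by (rule sum_fun_upd_diff)
    have sumb: "sum b' (T \<inter> J) = sum b (T \<inter> J) - (if t \<in> J then e else 0)" for J
      unfolding b'_def using fin t by (subst sum_fun_upd_diff) auto
    have hall': "sum a' I \<le> sum b' (T \<inter> E `` I)" if I: "I \<subseteq> S" for I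
    proof (cases "s \<notin> I \<and> t \<in> E `` I")
      case True
      then have "e \<le> sum b (T \<inter> E `` I) - sum a I"
        using I by (intro e_le) (auto simp: V_def \<I>_def)
      with True show ?thesis by (simp add: suma[OF I] sumb)
    next
      case False
      then show ?thesis
        using hall[OF I] \<open>0 \<le> e\<close> t(2) by (auto simp: suma[OF I] sumb)
    qed
    have a'0: "0 \<le> a' x" if "x \<in> S" for x
      using that e_as less.prems(3) by (auto simp: a'_def)
    have b'0: "0 \<le> b' x" if "x \<in> T" for x
      using that e_bt less.prems(4) by (auto simp: b'_def)
    have cardS: "card (S - {s}) < card S" and cardT: "card (T - {t}) < card T"
      using fin s t by (simp_all add: card_Diff1_less del: card_Diff_insert card_Diff_singleton)
    have "\<exists>w. transport_plan E S T a' b' w"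
    proof -
      consider "e = a s" | "e = b t" | I where "I \<in> \<I>" "e = sum b (T \<inter> E `` I) - sum a I"
        using eV by (auto simp: V_def)
      then show ?thesis
      proof cases
        case 1
        then have "a' s = 0" by (simp add: a'_def)
        have "\<exists>w. transport_plan E (S - {s}) T a' b' w"
          by (rule less.hyps) (use cardS fin a'0 b'0 in \<open>auto intro!: hall'\<close>)
        then obtain w where w: "transport_plan E (S - {s}) T a' b' w" ..
        have "transport_plan E S T a' b' w"
          by (rule transport_plan_extend[OF w]) (use fin \<open>a' s = 0\<close> b'0 in auto)
        then show ?thesis by blast
      next
        case 2
        then have "b' t = 0" by (simp add: b'_def)
        have "sum b' ((T - {t}) \<inter> J) = sum b' (T \<inter> J)" for J
          using fin \<open>b' t = 0\<close> by (intro sum.mono_neutral_left) auto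
        then have "\<exists>w. transport_plan E S (T - {t}) a' b' w"
          by (intro less.hyps) (use cardT fin a'0 b'0 in \<open>auto intro!: hall'\<close>)
        then obtain w where w: "transport_plan E S (T - {t}) a' b' w" ..
        have "transport_plan E S T a' b' w"
          by (rule transport_plan_extend[OF w]) (use fin b'0 in auto)
        then show ?thesis by blast
      next
        case (3 I)
        define J where "J = T \<inter> E `` I"
        have I: "I \<subseteq> S" "s \<notin> I" "t \<in> E `` I" "I \<noteq> {}"
          using 3(1) by (auto simp: \<I>_def)
        have tight: "sum a' I = sum b' J"
          using 3(2) I by (simp add: J_def suma sumb)
        have finIJ: "finite I" "finite J"
          using I fin finite_subset by (auto simp: J_def)
        \<comment> \<open>Both blocks are smaller already on the source side: \<open>s\<close> lies
          outside \<open>I\<close>, and \<open>I\<close> is nonempty because it reaches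
          \<open>t\<close>.\<close>
        have "card I < card S" "card J \<le> card T" "card (S - I) < card S" "card (T - J) \<le> card T"
          using I s fin by (auto simp: J_def intro!: psubset_card_mono card_mono)
        then have small: "card I + card J < card S + card T"
            "card (S - I) + card (T - J) < card S + card T"
          by auto
        have "sum a' I' \<le> sum b' (J \<inter> E `` I')" if "I' \<subseteq> I" for I'
        proof -
          have "J \<inter> E `` I' = T \<inter> E `` I'"
            using that by (auto simp: J_def)
          then show ?thesis using hall'[of I'] that I by auto
        qed
        then have "\<exists>w. transport_plan E I J a' b' w"
          by (intro less.hyps) (use small finIJ I a'0 b'0 in \<open>auto simp: J_def\<close>)
        then obtain w where w: "transport_plan E I J a' b' w" ..
        \<comment> \<open>Subtracting the equality for the tight set \<open>I\<close> from the Hall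
          inequality for \<open>I \<union> I'\<close> leaves the inequality for \<open>I'\<close>
          with the targets in \<open>J\<close> removed.\<close>
        have "sum a' I' \<le> sum b' ((T - J) \<inter> E `` I')" if "I' \<subseteq> S - I" for I'
        proof -
          have "sum a' I + sum a' I' = sum a' (I \<union> I')"
            using that fin finIJ finite_subset[OF that] by (intro sum.union_disjoint[symmetric]) auto
          also have "\<dots> \<le> sum b' (T \<inter> E `` (I \<union> I'))"
            using that I by (intro hall') auto
          also have "T \<inter> E `` (I \<union> I') = J \<union> (T - J) \<inter> E `` I'"
            by (auto simp: J_def)
          also have "sum b' \<dots> = sum b' J + sum b' ((T - J) \<inter> E `` I')"
            using fin finIJ by (intro sum.union_disjoint) auto
          finally show ?thesis using tight by simp
        qed
        then have "\<exists>v. transport_plan E (S - I) (T - J) a' b' v"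
          by (intro less.hyps) (use small fin a'0 b'0 in auto)
        then obtain v where v: "transport_plan E (S - I) (T - J) a' b' v" ..
        have "J \<subseteq> T" by (auto simp: J_def)
        from transport_plan_sum[OF w v \<open>I \<subseteq> S\<close> this fin] show ?thesis by blast
      qed
    qed
    then obtain w where "transport_plan E S T a' b' w" ..
    from transport_plan_add_edge[OF this[unfolded a'_def b'_def] s(1) t(1,2) \<open>0 \<le> e\<close> fin]
    show ?thesis by blast
  qed
qed

subsection \<open>Finitely additive couplings\<close>

text \<open>Charges are defined on all subsets, so \<open>R\<close> need not belong to the algebra
  generated by rectangles, and each condition constrains only finitely many coordinates of
  \<open>r\<close>, as the compactness argument requires.\<close>

definition charge_on :: "'c set \<Rightarrow> ('c set \<Rightarrow> real) \<Rightarrow> bool" where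
  "charge_on R r \<longleftrightarrow> (\<forall>M. 0 \<le> r M) \<and> (\<forall>M N. M \<inter> N = {} \<longrightarrow> r (M \<union> N) = r M + r N) \<and>
     r UNIV = 1 \<and> r R = 1"

text \<open>The atoms of the algebra generated by \<open>F\<close> are the sources, with their
  \<open>p\<close>-mass, and also the targets, with their \<open>q\<close>-mass. Two atoms are
  joined when \<open>R\<close> meets their product, and \<open>dom\<close> then yields the Hall
  condition.\<close>

lemma charge_on_finite_marginals:
  fixes p q :: "'a::topological_space measure" and R :: "('a \<times> 'a) set"
  assumes "prob_space p" "prob_space q" and sets: "sets p = sets borel" "sets q = sets borel"
    and dom: "\<And>A B. A \<in> sets borel \<Longrightarrow> B \<in> sets borel \<Longrightarrow> R `` A \<subseteq> B \<Longrightarrow> measure p A \<le> measure q B"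
    and F: "finite F" "F \<subseteq> sets borel"
  shows "\<exists>r. charge_on R r \<and> (\<forall>A\<in>F. r (A \<times> UNIV) = measure p A \<and> r (UNIV \<times> A) = measure q A)"
proof -
  interpret p: prob_space p by fact
  interpret q: prob_space q by fact
  have space: "space p = UNIV" "space q = UNIV"
    using sets[THEN sets_eq_imp_space_eq] by auto
  \<comment> \<open>\<open>g x\<close> names the atom of the algebra generated by \<open>F\<close> that contains \<open>x\<close>\<close>
  define g where "g x = {A \<in> F. x \<in> A}" for x
  define S where "S = Pow F"
  have S: "finite S" using F by (simp add: S_def)
  have gS: "g x \<in> S" for x by (auto simp: g_def S_def)
  have g1: "g -` {s} \<in> sets borel" if "s \<in> S" for s
  proof -
    have "g -` {s} = (\<Inter>A\<in>F. if A \<in> s then A else - A)"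
    proof (intro set_eqI)
      fix x
      have "g x = s \<longleftrightarrow> (\<forall>A\<in>F. x \<in> A \<longleftrightarrow> A \<in> s)"
        using that unfolding g_def S_def by blast
      then show "x \<in> g -` {s} \<longleftrightarrow> x \<in> (\<Inter>A\<in>F. if A \<in> s then A else - A)"
        unfolding INT_iff by auto
    qed
    also have "\<dots> \<in> sets borel"
      using F by (intro sets.countable_INT'') (auto intro: countable_finite)
    finally show ?thesis .
  qed
  have gI: "g -` I \<in> sets borel" if "I \<subseteq> S" for I
  proof -
    have "g -` I = (\<Union>s\<in>I. g -` {s})" by auto
    also have "\<dots> \<in> sets borel"
      using that g1 finite_subset[OF that S] by (intro sets.finite_UN) auto
    finally show ?thesis .
  qed
  define a where "a s = measure p (g -` {s})" for s
  define b where "b s = measure q (g -` {s})" for s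
  have suma: "sum a I = measure p (g -` I)" if "I \<subseteq> S" for I
  proof -
    have "measure p (\<Union>s\<in>I. g -` {s}) = sum a I"
      unfolding a_def using that g1 finite_subset[OF that S]
      by (intro p.finite_measure_finite_Union) (auto simp: sets disjoint_family_on_def)
    moreover have "(\<Union>s\<in>I. g -` {s}) = g -` I" by auto
    ultimately show ?thesis by simp
  qed
  have sumb: "sum b I = measure q (g -` I)" if "I \<subseteq> S" for I
  proof -
    have "measure q (\<Union>s\<in>I. g -` {s}) = sum b I"
      unfolding b_def using that g1 finite_subset[OF that S]
      by (intro q.finite_measure_finite_Union) (auto simp: sets disjoint_family_on_def)
    moreover have "(\<Union>s\<in>I. g -` {s}) = g -` I" by auto
    ultimately show ?thesis by simp
  qed
  have gU: "g -` S = UNIV" using gS by auto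
  have total: "sum a S = 1" "sum b S = 1"
    using p.prob_space q.prob_space by (simp_all add: suma sumb gU space)
  define E where "E = (\<lambda>(x, y). (g x, g y)) ` R"
  have "sum a I \<le> sum b (S \<inter> E `` I)" if I: "I \<subseteq> S" for I
  proof -
    have "R `` (g -` I) \<subseteq> g -` (S \<inter> E `` I)"
      using gS by (force simp: E_def)
    then have "measure p (g -` I) \<le> measure q (g -` (S \<inter> E `` I))"
      using I by (intro dom gI) auto
    then show ?thesis using I by (simp add: suma sumb)
  qed
  then have "\<exists>w. transport_plan E S S a b w"
    using S by (intro transport_plan_exists) (auto simp: a_def b_def)
  then obtain w where w: "transport_plan E S S a b w" ..
  have w0: "0 \<le> w s t" and wE: "w s t \<noteq> 0 \<Longrightarrow> (s, t) \<in> E" for s t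
    using w by (auto simp: transport_plan_def)
  have row: "(\<Sum>t\<in>S. w s t) = a s" if "s \<in> S" for s
    using w that by (simp add: transport_plan_def)
  \<comment> \<open>The columns lie below \<open>b\<close>, and both have total 1, so none of the
    inequalities can be strict.\<close>
  have col: "(\<Sum>s\<in>S. w s t) = b t" if "t \<in> S" for t
  proof (rule sum_mono_inv[OF _ _ that S])
    have "(\<Sum>t\<in>S. \<Sum>s\<in>S. w s t) = (\<Sum>s\<in>S. \<Sum>t\<in>S. w s t)"
      by (rule sum.swap)
    then show "(\<Sum>t\<in>S. \<Sum>s\<in>S. w s t) = sum b S"
      using row total by simp
    show "(\<Sum>s\<in>S. w s t) \<le> b t" if "t \<in> S" for t
      using w that by (simp add: transport_plan_def)
  qed
  \<comment> \<open>Each edge gets a representative point in \<open>R\<close>. The charge is the sum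
    of point masses at these representatives, weighted by the plan, and therefore sits on
    \<open>R\<close>.\<close>
  have "\<exists>c. \<forall>e\<in>E. c e \<in> R \<and> (g (fst (c e)), g (snd (c e))) = e"
    by (rule bchoice) (force simp: E_def)
  then obtain c where c: "\<And>e. e \<in> E \<Longrightarrow> c e \<in> R \<and> (g (fst (c e)), g (snd (c e))) = e"
    by blast
  define r where "r M = (\<Sum>s\<in>S. \<Sum>t\<in>S. w s t * indicator M (c (s, t)))" for M
  \<comment> \<open>Weights vanish off \<open>E\<close>, so membership in \<open>M\<close> has to be
    compared only at representatives of edges.\<close>
  have r_cong: "r M = (\<Sum>s\<in>S. \<Sum>t\<in>S. w s t * indicator Q (s, t))"
    if "\<And>s t. (s, t) \<in> E \<Longrightarrow> c (s, t) \<in> M \<longleftrightarrow> (s, t) \<in> Q" for M Q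
    unfolding r_def
  proof (intro sum.cong refl)
    fix s t
    show "w s t * indicator M (c (s, t)) = w s t * indicator Q (s, t)"
      using that[of s t] wE[of s t] by (cases "w s t = 0") (auto simp: indicator_def)
  qed
  have total_w: "(\<Sum>s\<in>S. \<Sum>t\<in>S. w s t) = 1"
    using row total by simp
  have "charge_on R r"
    unfolding charge_on_def
  proof (intro conjI allI impI)
    show "0 \<le> r M" for M
      unfolding r_def using w0 by (intro sum_nonneg mult_nonneg_nonneg) auto
    show "r (M \<union> N) = r M + r N" if "M \<inter> N = {}" for M N
      unfolding r_def sum.distrib[symmetric]
      using that by (intro sum.cong refl) (auto simp: indicator_def)
    show "r UNIV = 1" using r_cong[of UNIV UNIV] total_w by simp
    show "r R = 1" using r_cong[of R UNIV] c total_w by simp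
  qed
  moreover have "r (A \<times> UNIV) = measure p A \<and> r (UNIV \<times> A) = measure q A" if "A \<in> F" for A
  proof
    let ?Q = "{s \<in> S. A \<in> s}"
    have gA: "g -` ?Q = A"
      using that gS by (auto simp: g_def)
    have Ain: "x \<in> A \<longleftrightarrow> A \<in> g x" for x
      using that by (simp add: g_def)
    have "r (A \<times> UNIV) = (\<Sum>s\<in>S. \<Sum>t\<in>S. w s t * indicator (?Q \<times> UNIV) (s, t))"
    proof (rule r_cong)
      fix s t assume "(s, t) \<in> E"
      with c[OF this] gS show "c (s, t) \<in> A \<times> UNIV \<longleftrightarrow> (s, t) \<in> ?Q \<times> UNIV"
        by (cases "c (s, t)") (auto simp: Ain)
    qed
    also have "\<dots> = (\<Sum>s\<in>S. if A \<in> s then a s else 0)"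
      by (intro sum.cong refl) (auto simp: row[symmetric] indicator_def)
    also have "\<dots> = sum a ?Q"
      using S by (simp add: sum.inter_filter)
    also have "\<dots> = measure p A" by (subst suma) (auto simp only: gA)
    finally show "r (A \<times> UNIV) = measure p A" .
    have "r (UNIV \<times> A) = (\<Sum>s\<in>S. \<Sum>t\<in>S. w s t * indicator (UNIV \<times> ?Q) (s, t))"
    proof (rule r_cong)
      fix s t assume "(s, t) \<in> E"
      with c[OF this] gS show "c (s, t) \<in> UNIV \<times> A \<longleftrightarrow> (s, t) \<in> UNIV \<times> ?Q"
        by (cases "c (s, t)") (auto simp: Ain)
    qed
    also have "\<dots> = (\<Sum>t\<in>S. \<Sum>s\<in>S. w s t * indicator (UNIV \<times> ?Q) (s, t))"
      by (rule sum.swap)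
    also have "\<dots> = (\<Sum>t\<in>S. if A \<in> t then b t else 0)"
      by (intro sum.cong refl) (auto simp: col[symmetric] indicator_def)
    also have "\<dots> = sum b ?Q"
      using S by (simp add: sum.inter_filter)
    also have "\<dots> = measure q A" by (subst sumb) (auto simp only: gA)
    finally show "r (UNIV \<times> A) = measure q A" .
  qed
  ultimately show ?thesis by blast
qed

lemma charge_on_mono:
  assumes "charge_on R r" "M \<subseteq> N"
  shows "r M \<le> r N"
proof -
  have "M \<union> (N - M) = N" using assms by auto
  then have "r N = r M + r (N - M)"
    using assms(1) unfolding charge_on_def by (metis Diff_disjoint)
  moreover have "0 \<le> r (N - M)" using assms(1) by (simp add: charge_on_def)
  ultimately show ?thesis by simp
qed

lemma charge_on_le_1: "charge_on R r \<Longrightarrow> r M \<le> 1"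
  using charge_on_mono[of R r M UNIV] by (simp add: charge_on_def)

text \<open>The marginal condition of each Borel set is closed for pointwise convergence, and
  finitely many of them can be met together by \<open>charge_on_finite_marginals\<close>.
  Compactness gives one charge meeting all of them.\<close>

lemma charge_on_marginals:
  fixes p q :: "'a::topological_space measure" and R :: "('a \<times> 'a) set"
  assumes "prob_space p" "prob_space q" and sets: "sets p = sets borel" "sets q = sets borel"
    and dom: "\<And>A B. A \<in> sets borel \<Longrightarrow> B \<in> sets borel \<Longrightarrow> R `` A \<subseteq> B \<Longrightarrow> measure p A \<le> measure q B"
  shows "\<exists>r. charge_on R r \<and>
    (\<forall>A\<in>sets borel. r (A \<times> UNIV) = measure p A \<and> r (UNIV \<times> A) = measure q A)"
proof -
  define C where "C = (UNIV \<rightarrow>\<^sub>E {0..1::real}) \<inter> {r. charge_on R r}"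
  define D where "D A = {r :: ('a \<times> 'a) set \<Rightarrow> real.
    r (A \<times> UNIV) = measure p A \<and> r (UNIV \<times> A) = measure q A}" for A
  have closed_eq: "closed {r :: ('a \<times> 'a) set \<Rightarrow> real. f r = g r}"
    if "continuous_on UNIV f" "continuous_on UNIV g" for f g :: "_ \<Rightarrow> real"
    using that by (rule closed_Collect_eq)
  have "compact (UNIV \<rightarrow>\<^sub>E {0..1::real} :: (('a \<times> 'a) set \<Rightarrow> real) set)"
    using compactin_PiE[of "\<lambda>_. euclidean" UNIV "\<lambda>_::('a \<times> 'a) set. {0..1::real}"]
    by (simp add: euclidean_product_topology)
  \<comment> \<open>All conditions are equations or inequalities between finitely many coordinates.
    Countable additivity is in general lost under such limits, which is why it has to be recovered
    from regularity afterwards.\<close>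
  moreover have "closed {r :: ('a \<times> 'a) set \<Rightarrow> real. charge_on R r}"
    unfolding charge_on_def
    by (intro closed_Collect_conj closed_Collect_all closed_Collect_imp closed_Collect_le closed_eq
        open_Collect_const continuous_intros continuous_on_product_coordinates)
  ultimately have "compact C"
    unfolding C_def by (rule compact_Int_closed)
  have "C \<inter> \<Inter>(D ` sets borel) \<noteq> {}"
  proof (rule compact_imp_fip[OF \<open>compact C\<close>])
    show "closed T" if "T \<in> D ` sets borel" for T
      using that unfolding D_def
      by (auto intro!: closed_Collect_conj closed_eq continuous_intros continuous_on_product_coordinates)
    fix \<F> assume "finite \<F>" "\<F> \<subseteq> D ` sets borel"
    then obtain F where F: "finite F" "F \<subseteq> sets borel" "\<F> = D ` F"
      by (meson finite_subset_image)
    obtain r where r: "charge_on R r"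
      "\<forall>A\<in>F. r (A \<times> UNIV) = measure p A \<and> r (UNIV \<times> A) = measure q A"
      using charge_on_finite_marginals[OF assms(1,2) sets dom F(1,2)] by blast
    have "r \<in> C"
      using r(1) charge_on_le_1[OF r(1)] by (auto simp: C_def charge_on_def)
    moreover have "r \<in> \<Inter>\<F>"
      using r(2) by (auto simp: F(3) D_def)
    ultimately show "C \<inter> \<Inter>\<F> \<noteq> {}" by blast
  qed
  then show ?thesis by (auto simp: C_def D_def)
qed

lemma charge_on_Un:
  assumes "charge_on R r"
  shows "r (M \<union> N) \<le> r M + r N"
proof -
  have "r (M \<union> N) = r (M \<union> (N - M))" by simp
  also have "\<dots> = r M + r (N - M)"
    using assms unfolding charge_on_def by (metis Diff_disjoint)
  also have "\<dots> \<le> r M + r N"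
    using charge_on_mono[OF assms, of "N - M" N] by simp
  finally show ?thesis .
qed

lemma charge_on_empty: "charge_on R r \<Longrightarrow> r {} = 0"
  unfolding charge_on_def by (metis Int_empty_right Un_empty_right add_cancel_right_right)

lemma charge_on_Union_le:
  assumes "charge_on R r" "finite I"
  shows "r (\<Union>i\<in>I. M i) \<le> (\<Sum>i\<in>I. r (M i))"
  using assms(2)
proof induction
  case empty
  then show ?case using charge_on_empty[OF assms(1)] by simp
next
  case (insert i I)
  then show ?case using charge_on_Un[OF assms(1), of "M i" "\<Union>i\<in>I. M i"] by simp
qed

lemma charge_on_Union_disjoint:
  assumes "charge_on R r" "finite I" "disjoint_family_on M I"
  shows "r (\<Union>i\<in>I. M i) = (\<Sum>i\<in>I. r (M i))"
  using assms(2,3)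
proof induction
  case empty
  then show ?case using charge_on_empty[OF assms(1)] by simp
next
  case (insert i I)
  then have "disjoint_family_on M I" "M i \<inter> (\<Union>i\<in>I. M i) = {}"
    by (auto simp: disjoint_family_on_def)
  moreover from this have "r (M i \<union> (\<Union>i\<in>I. M i)) = r (M i) + r (\<Union>i\<in>I. M i)"
    using assms(1) unfolding charge_on_def by blast
  ultimately show ?case using insert by simp
qed

subsection \<open>From charges to measures\<close>

lemma radon_prob_inner:
  assumes "radon_prob p" "A \<in> sets borel" "0 < e"
  obtains K where "compact K" "K \<subseteq> A" "measure p A < measure p K + e"
\<comment> \<open>For small \<open>A\<close> the empty set serves; otherwise
  \<open>measure p A - e\<close> is nonnegative and \<open>ennreal\<close> does not truncate
  it.\<close>
proof (cases "measure p A < e")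
  case True
  then show ?thesis using that[of "{}"] by simp
next
  case False
  interpret prob_space p using assms by (simp add: radon_prob_def)
  have "ennreal (measure p A - e) < emeasure p A"
    using False \<open>0 < e\<close> by (auto simp: emeasure_eq_measure intro!: ennreal_lessI)
  also have "\<dots> = (SUP K \<in> {K. compact K \<and> K \<subseteq> A}. emeasure p K)"
    using assms by (simp add: radon_prob_def)
  finally obtain K where K: "compact K" "K \<subseteq> A" "ennreal (measure p A - e) < emeasure p K"
    by (auto simp: less_SUP_iff)
  then have "measure p A - e < measure p K"
    using False by (simp add: emeasure_eq_measure ennreal_less_iff)
  with K show ?thesis by (intro that) auto
qed

text \<open>Inner regularity of the complement: a compact set inside \<open>- A\<close> is closed,
  and its complement is the desired open set.\<close>

lemma radon_prob_outer:
  assumes "radon_prob p" "A \<in> sets borel" "0 < e"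
  obtains U where "open U" "A \<subseteq> U" "measure p U < measure p A + e"
proof -
  interpret prob_space p using assms by (simp add: radon_prob_def)
  have sp: "sets p = sets borel" using assms by (simp add: radon_prob_def)
  have sp': "space p = UNIV" using sets_eq_imp_space_eq[OF sp] by simp
  have compl: "measure p (- B) = 1 - measure p B" if "B \<in> sets borel" for B
    using prob_compl[of B] that by (simp add: sp sp' Compl_eq_Diff_UNIV)
  obtain K where K: "compact K" "K \<subseteq> - A" "measure p (- A) < measure p K + e"
    using radon_prob_inner[OF assms(1) _ assms(3), of "- A"] assms(2) by auto
  then have "closed K" by (simp add: compact_imp_closed)
  show ?thesis
    by (rule that[of "- K"]) (use K \<open>closed K\<close> compl[of K] compl[of A] assms(2) in auto)
qed

lemma semiring_of_sets_borel_rectangles: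
  "semiring_of_sets UNIV {A \<times> B | A B. A \<in> sets (borel :: 'a::topological_space measure) \<and>
     B \<in> sets (borel :: 'b::topological_space measure)}"
    (is "semiring_of_sets UNIV ?\<R>")
proof
  show "?\<R> \<subseteq> Pow UNIV" by simp
  show "{} \<in> ?\<R>" by blast
  fix M N assume "M \<in> ?\<R>" "N \<in> ?\<R>"
  then obtain A B C D where MN: "M = A \<times> B" "N = C \<times> D"
    and sets: "A \<in> sets borel" "B \<in> sets borel" "C \<in> sets borel" "D \<in> sets borel"
    by blast
  have "M \<inter> N = (A \<inter> C) \<times> (B \<inter> D)" using MN by auto
  with sets show "M \<inter> N \<in> ?\<R>" by blast
  have "(A - C) \<times> B \<in> ?\<R>" "(A \<inter> C) \<times> (B - D) \<in> ?\<R>"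
    using sets by blast+
  moreover have "M - N = \<Union>{(A - C) \<times> B, (A \<inter> C) \<times> (B - D)}" using MN by auto
  moreover have "disjoint {(A - C) \<times> B, (A \<inter> C) \<times> (B - D)}"
    by (auto simp: disjoint_def)
  ultimately show "\<exists>\<C>\<subseteq>?\<R>. finite \<C> \<and> disjoint \<C> \<and> M - N = \<Union>\<C>"
    by (intro exI[of _ "{(A - C) \<times> B, (A \<inter> C) \<times> (B - D)}"]) simp
qed

section \<open>Countable additivity on Borel rectangles\<close>

locale radon_charge =
  fixes p q :: "'a::metric_space measure" and R :: "('a \<times> 'a) set" and r :: "('a \<times> 'a) set \<Rightarrow> real"
  assumes p: "radon_prob p" and q: "radon_prob q" and r: "charge_on R r"
    and fst_marginal: "A \<in> sets borel \<Longrightarrow> r (A \<times> UNIV) = measure p A"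
    and snd_marginal: "A \<in> sets borel \<Longrightarrow> r (UNIV \<times> A) = measure q A"
begin

sublocale p: prob_space p using p by (simp add: radon_prob_def)
sublocale q: prob_space q using q by (simp add: radon_prob_def)

lemma sets_eq: "sets p = sets borel" "sets q = sets borel"
  using p q by (auto simp: radon_prob_def)

lemma nonneg: "0 \<le> r M"
  using r by (simp add: charge_on_def)

text \<open>What \<open>C \<times> D\<close> misses of \<open>A \<times> B\<close> lies in two
  strips whose charges are known from the marginals. This carries regularity of \<open>p\<close> and
  \<open>q\<close> over to rectangles.\<close>

lemma rectangle_le:
  assumes "A \<in> sets borel" "B \<in> sets borel" "C \<in> sets borel" "D \<in> sets borel" "C \<subseteq> A" "D \<subseteq> B"
  shows "r (A \<times> B) \<le> r (C \<times> D) + (measure p A - measure p C) + (measure q B - measure q D)"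
proof -
  have "r (A \<times> B) \<le> r (C \<times> D \<union> ((A - C) \<times> UNIV \<union> UNIV \<times> (B - D)))"
    by (rule charge_on_mono[OF r]) auto
  also have "\<dots> \<le> r (C \<times> D) + (r ((A - C) \<times> UNIV) + r (UNIV \<times> (B - D)))"
    using charge_on_Un[OF r] by (meson add_left_mono order_trans)
  also have "r ((A - C) \<times> UNIV) = measure p A - measure p C"
    using assms by (simp add: fst_marginal p.finite_measure_Diff sets_eq)
  also have "r (UNIV \<times> (B - D)) = measure q B - measure q D"
    using assms by (simp add: snd_marginal q.finite_measure_Diff sets_eq)
  finally show ?thesis by simp
qed

text \<open>Shrink \<open>C \<times> D\<close> to a compact rectangle, enlarge each
  \<open>A n \<times> B n\<close> to an open one, and pass to a finite subcover, where finite
  subadditivity applies.\<close>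

lemma rectangle_le_suminf:
  fixes A B :: "nat \<Rightarrow> 'a set"
  assumes AB[measurable]: "\<And>n. A n \<in> sets borel" "\<And>n. B n \<in> sets borel"
    and CD[measurable]: "C \<in> sets borel" "D \<in> sets borel"
    and Union: "(\<Union>n. A n \<times> B n) = C \<times> D" and summable: "summable (\<lambda>n. r (A n \<times> B n))"
  shows "r (C \<times> D) \<le> (\<Sum>n. r (A n \<times> B n))"
proof (rule field_le_epsilon)
  fix \<epsilon> :: real assume "0 < \<epsilon>"
  \<comment> \<open>Shrinking to \<open>K \<times> L\<close> costs at most \<open>2 * e\<close>.
    Enlarging costs at most \<open>2 * d n\<close> in the \<open>n\<close>-th rectangle, and the
    \<open>d n\<close> add up to \<open>e\<close>.\<close>
  define e where "e = \<epsilon> / 4"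
  have "0 < e" using \<open>0 < \<epsilon>\<close> by (simp add: e_def)
  obtain K where K: "compact K" "K \<subseteq> C" "measure p C < measure p K + e"
    using radon_prob_inner[OF p CD(1) \<open>0 < e\<close>] .
  obtain L where L: "compact L" "L \<subseteq> D" "measure q D < measure q L + e"
    using radon_prob_inner[OF q CD(2) \<open>0 < e\<close>] .
  define d where "d n = e * (1 / 2) ^ Suc n" for n
  have "d sums (e * 1)"
    unfolding d_def by (intro sums_mult power_half_series)
  have d: "0 < d n" for n
    using \<open>0 < e\<close> by (simp add: d_def)
  have "\<exists>U. open U \<and> A n \<subseteq> U \<and> measure p U < measure p (A n) + d n" for n
    using radon_prob_outer[OF p AB(1) d] by metis
  then obtain U where U: "\<And>n. open (U n)" "\<And>n. A n \<subseteq> U n"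
      "\<And>n. measure p (U n) < measure p (A n) + d n"
    by metis
  have "\<exists>V. open V \<and> B n \<subseteq> V \<and> measure q V < measure q (B n) + d n" for n
    using radon_prob_outer[OF q AB(2) d] by metis
  then obtain V where V: "\<And>n. open (V n)" "\<And>n. B n \<subseteq> V n"
      "\<And>n. measure q (V n) < measure q (B n) + d n"
    by metis
  have "K \<times> L \<subseteq> (\<Union>n. A n \<times> B n)"
    using K L Union by auto
  also have "\<dots> \<subseteq> (\<Union>n. U n \<times> V n)"
    using U(2) V(2) by (intro UN_mono) auto
  finally have "K \<times> L \<subseteq> (\<Union>n\<in>UNIV. U n \<times> V n)" .
  then obtain J where J: "finite J" "K \<times> L \<subseteq> (\<Union>n\<in>J. U n \<times> V n)"
    by (rule compactE_image[OF compact_Times[OF K(1) L(1)] open_Times[OF U(1) V(1)]]) (rule that)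
  have "r (C \<times> D) \<le> r (K \<times> L) + (measure p C - measure p K) + (measure q D - measure q L)"
    using K L by (intro rectangle_le) (auto simp: borel_compact)
  also have "\<dots> \<le> r (K \<times> L) + 2 * e"
    using K L by simp
  also have "r (K \<times> L) \<le> r (\<Union>n\<in>J. U n \<times> V n)"
    by (rule charge_on_mono[OF r J(2)])
  also have "\<dots> \<le> (\<Sum>n\<in>J. r (U n \<times> V n))"
    by (rule charge_on_Union_le[OF r J(1)])
  also have "\<dots> \<le> (\<Sum>n\<in>J. r (A n \<times> B n) + 2 * d n)"
  proof (rule sum_mono)
    fix n
    have "r (U n \<times> V n) \<le> r (A n \<times> B n) + (measure p (U n) - measure p (A n)) +
        (measure q (V n) - measure q (B n))"
      using U V AB by (intro rectangle_le) auto
    then show "r (U n \<times> V n) \<le> r (A n \<times> B n) + 2 * d n"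
      using U(3)[of n] V(3)[of n] by simp
  qed
  also have "\<dots> = (\<Sum>n\<in>J. r (A n \<times> B n)) + 2 * (\<Sum>n\<in>J. d n)"
    by (simp add: sum.distrib sum_distrib_left)
  also have "(\<Sum>n\<in>J. d n) \<le> e"
    using sum_le_suminf[of d J] \<open>d sums (e * 1)\<close> d J(1)
    by (auto simp: sums_iff intro: less_imp_le)
  also have "(\<Sum>n\<in>J. r (A n \<times> B n)) \<le> (\<Sum>n. r (A n \<times> B n))"
    by (rule sum_le_suminf[OF summable J(1)]) (simp add: nonneg)
  finally show "r (C \<times> D) \<le> (\<Sum>n. r (A n \<times> B n)) + \<epsilon>"
    by (simp add: e_def)
qed

text \<open>Finite additivity and monotonicity bound the partial sums by the whole; the converse
  inequality is \<open>rectangle_le_suminf\<close>.\<close>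

lemma suminf_rectangles:
  fixes A B :: "nat \<Rightarrow> 'a set"
  assumes AB: "\<And>n. A n \<in> sets borel" "\<And>n. B n \<in> sets borel"
    and CD: "C \<in> sets borel" "D \<in> sets borel"
    and disj: "disjoint_family (\<lambda>n. A n \<times> B n)" and Union: "(\<Union>n. A n \<times> B n) = C \<times> D"
  shows "(\<Sum>n. ennreal (r (A n \<times> B n))) = ennreal (r (C \<times> D))"
proof -
  have le: "(\<Sum>n<N. r (A n \<times> B n)) \<le> r (C \<times> D)" for N
  proof -
    have "(\<Sum>n<N. r (A n \<times> B n)) = r (\<Union>n<N. A n \<times> B n)"
      using disj by (intro charge_on_Union_disjoint[OF r, symmetric])
        (auto simp: disjoint_family_on_def)
    also have "\<dots> \<le> r (C \<times> D)"
      using Union by (intro charge_on_mono[OF r]) auto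
    finally show ?thesis .
  qed
  have summable: "summable (\<lambda>n. r (A n \<times> B n))"
    by (rule summableI_nonneg_bounded[OF nonneg le])
  have "(\<Sum>n. r (A n \<times> B n)) = r (C \<times> D)"
    by (intro antisym suminf_le_const[OF summable le] rectangle_le_suminf AB CD Union summable)
  then show ?thesis
    using suminf_ennreal2[OF nonneg summable] by simp
qed

text \<open>Borel rectangles form a semiring generating the product \<sigma>-algebra, so
  Caratheodory's theorem applies. Agreement with \<open>r\<close> is obtained on rectangles
  only.\<close>

lemma product_measure_exists:
  obtains \<mu> :: "('a \<times> 'a) measure" where "sets \<mu> = sets (borel \<Otimes>\<^sub>M borel)"
    "\<And>A B. A \<in> sets borel \<Longrightarrow> B \<in> sets borel \<Longrightarrow> emeasure \<mu> (A \<times> B) = ennreal (r (A \<times> B))"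
proof -
  define I where "I = {A \<times> B | A B. A \<in> sets (borel :: 'a measure) \<and> B \<in> sets (borel :: 'a measure)}"
  define \<mu> where "\<mu> = extend_measure UNIV I (\<lambda>M. M) (\<lambda>M. ennreal (r M))"
  have "sets \<mu> = sigma_sets UNIV I"
    unfolding \<mu>_def by (subst sets_extend_measure) auto
  also have "\<dots> = sets (borel \<Otimes>\<^sub>M borel)"
    by (simp add: sets_pair_measure I_def)
  finally have sets: "sets \<mu> = sets (borel \<Otimes>\<^sub>M borel)" .
  have "emeasure \<mu> M = ennreal (r M)" if "M \<in> I" for M
  proof (rule extend_measure_caratheodory[OF \<mu>_def that])
    show "semiring_of_sets UNIV ((\<lambda>M. M) ` I)"
      using semiring_of_sets_borel_rectangles by (simp add: I_def)
    fix X :: "nat \<Rightarrow> ('a \<times> 'a) set" and Y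
    assume X: "X \<in> UNIV \<rightarrow> I" and Y: "Y \<in> I" and disj: "disjoint_family ((\<lambda>M. M) \<circ> X)"
      and Un: "(\<Union>n. X n) = Y"
    have "\<exists>A B. X n = A \<times> B \<and> A \<in> sets borel \<and> B \<in> sets borel" for n
      using X by (auto simp: I_def Pi_iff)
    then obtain A B where AB: "\<And>n. X n = A n \<times> B n"
        "\<And>n. A n \<in> sets borel" "\<And>n. B n \<in> sets borel"
      by metis
    obtain C D where CD: "Y = C \<times> D" "C \<in> sets borel" "D \<in> sets borel"
      using Y by (auto simp: I_def)
    have "X = (\<lambda>n. A n \<times> B n)" using AB(1) by auto
    then show "(\<Sum>n. ennreal (r (X n))) = ennreal (r Y)"
      using suminf_rectangles[OF AB(2,3) CD(2,3)] disj Un CD(1) by (simp add: comp_def)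
  qed (auto simp: charge_on_empty[OF r])
  then show ?thesis
    by (intro that[OF sets]) (auto simp: I_def)
qed

end

section \<open>Separable carriers and countable covers by rectangles\<close>

lemma radon_prob_sigma_compact:
  assumes "radon_prob p"
  shows "\<exists>K :: nat \<Rightarrow> 'a::metric_space set. (\<forall>n. compact (K n)) \<and> measure p (\<Union>n. K n) = 1"
proof -
  interpret prob_space p using assms by (simp add: radon_prob_def)
  have sets: "sets p = sets borel" using assms by (simp add: radon_prob_def)
  have space: "space p = UNIV" using sets_eq_imp_space_eq[OF sets] by simp
  have "\<exists>K. compact K \<and> 1 < measure p K + 1 / real (Suc n)" for n
    using radon_prob_inner[OF assms, of UNIV "1 / real (Suc n)"] prob_space
    by (metis space sets.space_closed space_borel sets.top of_nat_0_less_iff zero_less_Suc zero_less_divide_1_iff)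
  then obtain K where K: "\<And>n. compact (K n)" "\<And>n. 1 < measure p (K n) + 1 / real (Suc n)"
    by metis
  have "1 \<le> measure p (\<Union>n. K n)"
  proof (rule field_le_epsilon)
    fix e :: real assume "0 < e"
    then obtain n where "1 / real (Suc n) < e" by (rule nat_approx_posE)
    moreover have "measure p (K n) \<le> measure p (\<Union>n. K n)"
      using K(1) by (intro finite_measure_mono) (auto simp: sets borel_compact)
    ultimately show "1 \<le> measure p (\<Union>n. K n) + e" using K(2)[of n] by linarith
  qed
  then show ?thesis
    using prob_le_1 K(1) by (intro exI[of _ K] conjI allI antisym)
qed

lemma sigma_compact_separable:
  fixes K :: "nat \<Rightarrow> 'a::metric_space set"
  assumes "\<And>n. compact (K n)"
  obtains D where "countable D" "\<And>x e. x \<in> (\<Union>n. K n) \<Longrightarrow> 0 < e \<Longrightarrow> \<exists>d\<in>D. dist d x < e"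
proof -
  have "\<exists>F. finite F \<and> K n \<subseteq> (\<Union>x\<in>F. ball x (1 / real (Suc m)))" for n m
    using assms[of n] unfolding compact_eq_totally_bounded
    by (meson of_nat_0_less_iff zero_less_Suc zero_less_divide_1_iff)
  then obtain F where F: "\<And>n m. finite (F n m)"
      "\<And>n m. K n \<subseteq> (\<Union>x\<in>F n m. ball x (1 / real (Suc m)))"
    by metis
  show ?thesis
  proof (rule that[of "\<Union>n m. F n m"])
    show "countable (\<Union>n m. F n m)" using F(1) by (intro countable_UN countableI_type countable_finite)
    fix x and e :: real assume "x \<in> (\<Union>n. K n)" "0 < e"
    then obtain n m where "x \<in> K n" "1 / real (Suc m) < e" by (auto elim: nat_approx_posE)
    with F(2)[of n m] obtain d where "d \<in> F n m" "dist d x < e" by fastforce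
    then show "\<exists>d\<in>\<Union>n m. F n m. dist d x < e" by blast
  qed
qed

text \<open>Among products of balls with centres in \<open>D\<close> and radii
  \<open>1 / (n + 1)\<close>, those inside \<open>G\<close> cover all points of \<open>G\<close>
  with both coordinates in \<open>S\<close>.\<close>

lemma open_countable_rectangles:
  fixes G :: "('a::metric_space \<times> 'a) set"
  assumes "open G" "countable D" and dense: "\<And>x e. x \<in> S \<Longrightarrow> 0 < e \<Longrightarrow> \<exists>d\<in>D. dist d x < e"
  obtains \<U> where "countable \<U>" "\<And>U V. (U, V) \<in> \<U> \<Longrightarrow> open U \<and> open V \<and> U \<times> V \<subseteq> G"
    "G \<inter> S \<times> S \<subseteq> (\<Union>(U, V)\<in>\<U>. U \<times> V)"
proof -
  define B where "B = (\<lambda>(x, y, n). (ball x (1 / real (Suc n)), ball y (1 / real (Suc n)))) ` (D \<times> D \<times> UNIV)"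
  define \<U> where "\<U> = {(U, V) \<in> B. U \<times> V \<subseteq> G}"
  have "countable B" using \<open>countable D\<close> by (auto simp: B_def)
  then have "countable \<U>" by (rule countable_subset[rotated]) (auto simp: \<U>_def)
  moreover have "open U \<and> open V \<and> U \<times> V \<subseteq> G" if "(U, V) \<in> \<U>" for U V
    using that by (auto simp: \<U>_def B_def)
  moreover have "G \<inter> S \<times> S \<subseteq> (\<Union>(U, V)\<in>\<U>. U \<times> V)"
  proof safe
    fix x y assume xy: "(x, y) \<in> G" "x \<in> S" "y \<in> S"
    obtain X Y where XY: "open X" "open Y" "(x, y) \<in> X \<times> Y" "X \<times> Y \<subseteq> G"
      using open_prod_elim[OF \<open>open G\<close> xy(1)] by blast
    obtain e1 where e1: "0 < e1" "ball x e1 \<subseteq> X"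
      using openE[OF XY(1), of x] XY(3) by auto
    obtain e2 where e2: "0 < e2" "ball y e2 \<subseteq> Y"
      using openE[OF XY(2), of y] XY(3) by auto
    \<comment> \<open>The factor 2 comes from the triangle inequality: a ball of radius
      \<open>s\<close> whose centre is within \<open>s\<close> of \<open>x\<close> lies in the ball
      of radius \<open>2 * s\<close> about \<open>x\<close>.\<close>
    have "0 < min e1 e2 / 2" using e1 e2 by simp
    then obtain n where n: "1 / real (Suc n) < min e1 e2 / 2"
      by (rule nat_approx_posE)
    define s where "s = 1 / real (Suc n)"
    have s: "0 < s" "2 * s < e1" "2 * s < e2" using n by (auto simp: s_def)
    obtain a where a: "a \<in> D" "dist a x < s" using dense[OF xy(2) s(1)] by blast
    obtain b where b: "b \<in> D" "dist b y < s" using dense[OF xy(3) s(1)] by blast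
    have "ball a s \<subseteq> X"
    proof
      fix z assume "z \<in> ball a s"
      then have "dist x z < e1"
        using dist_triangle[of x z a] a s by (simp add: dist_commute)
      then show "z \<in> X" using e1 by auto
    qed
    moreover have "ball b s \<subseteq> Y"
    proof
      fix z assume "z \<in> ball b s"
      then have "dist y z < e2"
        using dist_triangle[of y z b] b s by (simp add: dist_commute)
      then show "z \<in> Y" using e2 by auto
    qed
    ultimately have "ball a s \<times> ball b s \<subseteq> G" using XY(4) by blast
    moreover have "(ball a s, ball b s) \<in> B"
      unfolding B_def s_def using a b by (intro image_eqI[of _ _ "(a, b, n)"]) auto
    ultimately have "(ball a s, ball b s) \<in> \<U>" by (simp add: \<U>_def)
    moreover have "(x, y) \<in> ball a s \<times> ball b s" using a b by simp
    ultimately show "(x, y) \<in> (\<Union>(U, V)\<in>\<U>. U \<times> V)" by blast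
  qed
  ultimately show ?thesis by (rule that)
qed

section \<open>The coupling on the Borel sets of the product space\<close>

context radon_charge
begin

text \<open>The measure \<open>\<mu>\<close> is available on the product \<sigma>-algebra only.
  Restricted to the square of a \<sigma>-compact set of full mass for \<open>p\<close> and
  \<open>q\<close>, it measures every Borel set of the product space.\<close>

lemma coupling_exists:
  assumes "closed R"
  shows "\<exists>\<rho>. coupling \<rho> p q \<and> emeasure \<rho> (- R) = 0"
proof -
  obtain \<mu> :: "('a \<times> 'a) measure" where sets_\<mu>: "sets \<mu> = sets (borel \<Otimes>\<^sub>M borel)"
    and \<mu>: "\<And>A B. A \<in> sets borel \<Longrightarrow> B \<in> sets borel \<Longrightarrow> emeasure \<mu> (A \<times> B) = ennreal (r (A \<times> B))"
    by (rule product_measure_exists) (rule that)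
  have space_\<mu>: "space \<mu> = UNIV"
    using sets_eq_imp_space_eq[OF sets_\<mu>] by (simp add: space_pair_measure)
  obtain K :: "nat \<Rightarrow> 'a set" where "(\<forall>n. compact (K n)) \<and> measure p (\<Union>n. K n) = 1"
    using radon_prob_sigma_compact[OF p] ..
  then have K: "\<And>n. compact (K n)" "measure p (\<Union>n. K n) = 1" by auto
  obtain L :: "nat \<Rightarrow> 'a set" where "(\<forall>n. compact (L n)) \<and> measure q (\<Union>n. L n) = 1"
    using radon_prob_sigma_compact[OF q] ..
  then have L: "\<And>n. compact (L n)" "measure q (\<Union>n. L n) = 1" by auto
  define S where "S = (\<Union>n. K n \<union> L n)"
  have KL: "compact (K n \<union> L n)" for n
    by (intro compact_Un K L)
  obtain D where D: "countable D" "\<And>x e. x \<in> S \<Longrightarrow> 0 < e \<Longrightarrow> \<exists>d\<in>D. dist d x < e"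
    by (rule sigma_compact_separable[of "\<lambda>n. K n \<union> L n", OF KL, folded S_def]) (rule that)
  have S[measurable]: "S \<in> sets borel"
    unfolding S_def using K L by (intro sets.countable_UN) (auto simp: borel_compact)
  have KS: "(\<Union>n. K n) \<subseteq> S" and LS: "(\<Union>n. L n) \<subseteq> S"
    by (auto simp: S_def)
  have pS: "measure p S = 1"
    using p.finite_measure_mono[OF KS] S K(2) p.prob_le_1[of S] by (simp add: sets_eq)
  have qS: "measure q S = 1"
    using q.finite_measure_mono[OF LS] S L(2) q.prob_le_1[of S] by (simp add: sets_eq)
  have p_Int: "measure p (A \<inter> S) = measure p A" if "A \<in> sets borel" for A
    using p.prob_eq_1[of S] pS that S by (intro p.finite_measure_eq_AE) (auto simp: sets_eq)
  have q_Int: "measure q (A \<inter> S) = measure q A" if "A \<in> sets borel" for A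
    using q.prob_eq_1[of S] qS that S by (intro q.finite_measure_eq_AE) (auto simp: sets_eq)
  have T: "S \<times> S \<in> sets \<mu>" by (simp add: sets_\<mu>)
  \<comment> \<open>Inside \<open>S \<times> S\<close> an open set is a countable union of open
    rectangles, so the identity is measurable into the Borel sets; \<open>\<rho>\<close> is the
    push-forward along it.\<close>
  have meas: "(\<lambda>z. z) \<in> restrict_space \<mu> (S \<times> S) \<rightarrow>\<^sub>M borel"
  proof (rule borel_measurableI)
    fix G :: "('a \<times> 'a) set" assume "open G"
    then obtain \<U> where \<U>: "countable \<U>" "\<And>U V. (U, V) \<in> \<U> \<Longrightarrow> open U \<and> open V \<and> U \<times> V \<subseteq> G"
        "G \<inter> S \<times> S \<subseteq> (\<Union>(U, V)\<in>\<U>. U \<times> V)"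
      using open_countable_rectangles[OF _ D] by metis
    have "(\<Union>(U, V)\<in>\<U>. U \<times> V) \<in> sets \<mu>"
      using \<U>(1,2) by (intro sets.countable_UN') (auto simp: sets_\<mu>)
    moreover have "G \<inter> S \<times> S = (S \<times> S) \<inter> (\<Union>(U, V)\<in>\<U>. U \<times> V)"
      using \<U>(2,3) by blast
    ultimately show "(\<lambda>z. z) -` G \<inter> space (restrict_space \<mu> (S \<times> S)) \<in> sets (restrict_space \<mu> (S \<times> S))"
      using T by (auto simp: sets_restrict_space space_restrict_space space_\<mu>)
  qed
  define \<rho> where "\<rho> = distr (restrict_space \<mu> (S \<times> S)) borel (\<lambda>z. z)"
  have sets_\<rho>: "sets \<rho> = sets borel" by (simp add: \<rho>_def)
  have space_\<rho>: "space \<rho> = UNIV" by (simp add: \<rho>_def)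
  have \<rho>: "emeasure \<rho> M = emeasure \<mu> (M \<inter> S \<times> S)" if "M \<in> sets borel" for M
    using that meas T
    by (simp add: \<rho>_def emeasure_distr emeasure_restrict_space space_restrict_space space_\<mu>)
  have rect: "emeasure \<rho> (A \<times> B) = ennreal (r (A \<times> B))"
    if AB: "A \<in> sets borel" "B \<in> sets borel" "A \<times> B \<in> sets borel" for A B
  proof -
    have "A \<times> B \<inter> S \<times> S = (A \<inter> S) \<times> (B \<inter> S)" by auto
    \<comment> \<open>Cutting both sides down to \<open>S\<close> changes neither marginal mass, so
      \<open>rectangle_le\<close> shows that no charge is lost.\<close>
    moreover have "r ((A \<inter> S) \<times> (B \<inter> S)) = r (A \<times> B)"
    proof (rule antisym)
      show "r ((A \<inter> S) \<times> (B \<inter> S)) \<le> r (A \<times> B)"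
        by (rule charge_on_mono[OF r]) auto
      show "r (A \<times> B) \<le> r ((A \<inter> S) \<times> (B \<inter> S))"
        using rectangle_le[of A B "A \<inter> S" "B \<inter> S"] AB by (simp add: p_Int q_Int)
    qed
    ultimately show ?thesis using AB by (simp add: \<rho> \<mu>)
  qed
  have fst_meas: "fst \<in> borel_measurable \<rho>" and snd_meas: "snd \<in> borel_measurable \<rho>"
    unfolding measurable_cong_sets[OF sets_\<rho> refl]
    by (intro borel_measurable_continuous_onI continuous_on_fst continuous_on_snd continuous_on_id)+
  have Times_vimage: "A \<times> (UNIV :: 'a set) = fst -` A" "(UNIV :: 'a set) \<times> A = snd -` A" for A :: "'a set"
    by auto
  have sets_Times: "A \<times> (UNIV :: 'a set) \<in> sets borel" "(UNIV :: 'a set) \<times> A \<in> sets borel" if "A \<in> sets borel" for A :: "'a set"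
    using measurable_sets[OF fst_meas that] measurable_sets[OF snd_meas that]
    by (simp_all add: Times_vimage space_\<rho> sets_\<rho>)
  have "prob_space \<rho>"
    by (rule prob_spaceI) (use rect[of UNIV UNIV] r in \<open>simp add: space_\<rho> charge_on_def\<close>)
  moreover have "distr \<rho> borel fst = p"
  proof (rule measure_eqI)
    fix A assume "A \<in> sets (distr \<rho> borel fst)"
    then have A: "A \<in> sets borel" by simp
    then have "emeasure (distr \<rho> borel fst) A = emeasure \<rho> (A \<times> UNIV)"
      using fst_meas by (simp add: emeasure_distr space_\<rho> Times_vimage)
    also have "\<dots> = emeasure p A"
      using A by (simp add: rect sets_Times fst_marginal p.emeasure_eq_measure)
    finally show "emeasure (distr \<rho> borel fst) A = emeasure p A" .
  qed (simp add: sets_eq)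
  moreover have "distr \<rho> borel snd = q"
  proof (rule measure_eqI)
    fix A assume "A \<in> sets (distr \<rho> borel snd)"
    then have A: "A \<in> sets borel" by simp
    then have "emeasure (distr \<rho> borel snd) A = emeasure \<rho> (UNIV \<times> A)"
      using snd_meas by (simp add: emeasure_distr space_\<rho> Times_vimage)
    also have "\<dots> = emeasure q A"
      using A by (simp add: rect sets_Times snd_marginal q.emeasure_eq_measure)
    finally show "emeasure (distr \<rho> borel snd) A = emeasure q A" .
  qed (simp add: sets_eq)
  moreover have "emeasure \<rho> (- R) = 0"
  proof -
    have "open (- R)" using \<open>closed R\<close> by (simp add: open_Compl)
    then obtain \<U> where \<U>: "countable \<U>" "\<And>U V. (U, V) \<in> \<U> \<Longrightarrow> open U \<and> open V \<and> U \<times> V \<subseteq> - R"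
        "- R \<inter> S \<times> S \<subseteq> (\<Union>(U, V)\<in>\<U>. U \<times> V)"
      using open_countable_rectangles[OF _ D] by metis
    have "r (- R) = 0"
    proof -
      have "r (R \<union> - R) = r R + r (- R)"
        using r unfolding charge_on_def by (metis Compl_disjoint)
      then show ?thesis using r by (simp add: charge_on_def)
    qed
    \<comment> \<open>Each rectangle inside \<open>- R\<close> has charge 0, hence is
      \<open>\<mu>\<close>-null. The passage to the countable union uses \<open>\<mu>\<close>, since
      \<open>r\<close> is only known to be finitely additive.\<close>
    have null: "(\<Union>z\<in>\<U>. fst z \<times> snd z) \<in> null_sets \<mu>"
    proof (rule null_sets_UN'[OF \<U>(1)])
      fix z assume "z \<in> \<U>"
      then have z: "open (fst z)" "open (snd z)" "fst z \<times> snd z \<subseteq> - R"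
        using \<U>(2)[of "fst z" "snd z"] by auto
      then have "r (fst z \<times> snd z) = 0"
        using charge_on_mono[OF r z(3)] \<open>r (- R) = 0\<close> nonneg[of "fst z \<times> snd z"] by simp
      with z show "fst z \<times> snd z \<in> null_sets \<mu>"
        by (simp add: null_sets_def \<mu> sets_\<mu>)
    qed
    have "- R \<inter> S \<times> S \<subseteq> (\<Union>z\<in>\<U>. fst z \<times> snd z)"
      using \<U>(3) by (simp add: case_prod_beta)
    then have "emeasure \<mu> (- R \<inter> S \<times> S) \<le> emeasure \<mu> (\<Union>z\<in>\<U>. fst z \<times> snd z)"
      by (rule emeasure_mono) (rule null_setsD2[OF null])
    then have "emeasure \<mu> (- R \<inter> S \<times> S) = 0"
      unfolding null_setsD1[OF null] by simp
    then show ?thesis using \<rho>[OF borel_open[OF \<open>open (- R)\<close>]] by simp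
  qed
  ultimately show ?thesis
    using sets_\<rho> by (intro exI[of _ \<rho>]) (simp add: coupling_def)
qed

end

subsection \<open>Upsets in L-ordered metric spaces\<close>

lemma short_real_iff:
  fixes f :: "'a::metric_space \<Rightarrow> real"
  shows "short f \<longleftrightarrow> (\<forall>x y. f x - f y \<le> dist x y)"
proof
  show "\<forall>x y. f x - f y \<le> dist x y" if "short f"
    using that unfolding short_def lipschitz_on_def by (auto simp: dist_real_def abs_le_iff)
next
  assume *: "\<forall>x y. f x - f y \<le> dist x y"
  have "dist (f x) (f y) \<le> 1 * dist x y" for x y
    using *[rule_format, of x y] *[rule_format, of y x] by (auto simp: dist_real_def dist_commute)
  then show "short f"
    by (auto simp: short_def lipschitz_on_def)
qed

lemma short_continuous: "short f \<Longrightarrow> continuous_on UNIV f"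
  by (auto simp: short_def intro: lipschitz_on_continuous_on)

text \<open>The function \<open>\<rho>\<close> is an asymmetric distance dominated by
  \<open>dist\<close>; L-orderedness says that it vanishes exactly when \<open>x \<le> y\<close>.
  Then \<open>\<phi>\<close> is the \<open>\<rho>\<close>-distance from \<open>K\<close>.\<close>

lemma L_ordered_upset_distance:
  fixes K :: "'a::{metric_space, order} set"
  assumes L: "L_ordered_metric_space TYPE('a)" and K: "compact K" "K \<noteq> {}"
  obtains \<phi> :: "'a \<Rightarrow> real" where "short \<phi>" "antimono \<phi>" "\<And>y. 0 \<le> \<phi> y"
    "\<And>y. \<phi> y = 0 \<longleftrightarrow> (\<exists>x\<in>K. x \<le> y)"
proof -
  define \<F> where "\<F> = {f :: 'a \<Rightarrow> real. short f \<and> mono f}"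
  define \<rho> where "\<rho> x y = (SUP f\<in>\<F>. f x - f y)" for x y
  \<comment> \<open>The zero function makes the supremum one over a nonempty set and forces
    \<open>\<rho>\<close> to be nonnegative.\<close>
  have \<F>0: "(\<lambda>_. 0) \<in> \<F>"
    by (auto simp: \<F>_def short_real_iff mono_def)
  have bdd: "bdd_above ((\<lambda>f. f x - f y) ` \<F>)" for x y
    by (rule bdd_aboveI[of _ "dist x y"]) (auto simp: \<F>_def short_real_iff)
  have \<rho>_ge: "f x - f y \<le> \<rho> x y" if "f \<in> \<F>" for f x y
    unfolding \<rho>_def by (rule cSUP_upper[OF that bdd])
  have \<rho>_le: "\<rho> x y \<le> c" if "\<And>f. f \<in> \<F> \<Longrightarrow> f x - f y \<le> c" for x y c
    unfolding \<rho>_def using \<F>0 that by (intro cSUP_least) auto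
  have nonneg: "0 \<le> \<rho> x y" for x y
    using \<rho>_ge[OF \<F>0] by simp
  have dist: "\<rho> x y \<le> dist x y" for x y
    by (rule \<rho>_le) (auto simp: \<F>_def short_real_iff)
  have tri: "\<rho> x z \<le> \<rho> x y + \<rho> y z" for x y z
    by (rule \<rho>_le) (use \<rho>_ge[of _ x y] \<rho>_ge[of _ y z] in force)
  have zero_iff: "\<rho> x y \<le> 0 \<longleftrightarrow> x \<le> y" for x y
  proof
    assume "\<rho> x y \<le> 0"
    then have "f x \<le> f y" if "f \<in> \<F>" for f
      using \<rho>_ge[OF that, of x y] by linarith
    then show "x \<le> y"
      using L unfolding L_ordered_metric_space_def \<F>_def by blast
  next
    assume "x \<le> y"
    then show "\<rho> x y \<le> 0"
      by (intro \<rho>_le) (auto simp: \<F>_def mono_def)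
  qed
  define \<phi> where "\<phi> y = (INF k\<in>K. \<rho> k y)" for y
  have bddK: "bdd_below ((\<lambda>k. \<rho> k y) ` K)" for y
    by (rule bdd_belowI[of _ 0]) (auto simp: nonneg)
  have \<phi>_le: "\<phi> y \<le> \<rho> k y" if "k \<in> K" for k y
    unfolding \<phi>_def by (rule cINF_lower[OF bddK that])
  have \<phi>_ge: "c \<le> \<phi> y" if "\<And>k. k \<in> K \<Longrightarrow> c \<le> \<rho> k y" for c y
    unfolding \<phi>_def using K that by (intro cINF_greatest) auto
  \<comment> \<open>This one inequality gives both properties of \<open>\<phi>\<close>: shortness
    from \<open>\<rho> z y \<le> dist z y\<close>, and antitonicity because
    \<open>\<rho> z y \<le> 0\<close> for \<open>z \<le> y\<close>.\<close>
  have \<phi>_tri: "\<phi> y - \<rho> z y \<le> \<phi> z" for y z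
  proof (rule \<phi>_ge)
    fix k assume "k \<in> K"
    from \<phi>_le[OF this, of y] tri[of k y z] show "\<phi> y - \<rho> z y \<le> \<rho> k z" by simp
  qed
  \<comment> \<open>Here compactness enters: a zero of \<open>\<phi>\<close> must come from an
    actual point of \<open>K\<close> below \<open>y\<close>, not merely from a minimizing
    sequence.\<close>
  have attained: "\<exists>k\<in>K. \<rho> k y \<le> \<phi> y" for y
  proof -
    have "short (\<lambda>k. \<rho> k y)"
      unfolding short_real_iff
    proof (intro allI)
      fix k l
      show "\<rho> k y - \<rho> l y \<le> dist k l" using tri[of k y l] dist[of k l] by simp
    qed
    then have "continuous_on K (\<lambda>k. \<rho> k y)"
      using short_continuous continuous_on_subset by blast
    from continuous_attains_inf[OF K this] obtain k where "k \<in> K" "\<forall>l\<in>K. \<rho> k y \<le> \<rho> l y"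
      by blast
    then show ?thesis using \<phi>_ge by blast
  qed
  show ?thesis
  proof (rule that[of \<phi>])
    show "short \<phi>"
      unfolding short_real_iff
    proof (intro allI)
      fix x y
      show "\<phi> x - \<phi> y \<le> dist x y"
        using \<phi>_tri[of x y] dist[of y x] by (simp add: dist_commute)
    qed
    show "antimono \<phi>"
    proof (rule antimonoI)
      fix x y :: 'a assume "x \<le> y"
      then show "\<phi> y \<le> \<phi> x" using \<phi>_tri[of y x] zero_iff[of x y] by simp
    qed
    show \<phi>0: "0 \<le> \<phi> y" for y
      by (rule \<phi>_ge[OF nonneg])
    show "\<phi> y = 0 \<longleftrightarrow> (\<exists>x\<in>K. x \<le> y)" for y
      using attained[of y] \<phi>_le[of _ y] \<phi>0[of y] zero_iff[of _ y] by force
  qed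
qed

text \<open>The sets \<open>U n\<close> on which \<open>\<phi>\<close> is below
  \<open>1 / (n + 1)\<close> decrease to the up-closure of \<open>K\<close>, which gives its
  measurability and, by continuity from above, the bound.\<close>

lemma measure_compact_le_measure_upset:
  fixes p q :: "'a::{metric_space, order} measure"
  assumes L: "L_ordered_metric_space TYPE('a)"
    and p: "p \<in> finite_moment_measures" and q: "q \<in> finite_moment_measures"
    and le: "\<And>f :: 'a \<Rightarrow> real. short f \<Longrightarrow> mono f \<Longrightarrow> (\<integral>x. f x \<partial>p) \<le> (\<integral>x. f x \<partial>q)"
    and K: "compact K"
  shows "{y. \<exists>x\<in>K. x \<le> y} \<in> sets borel \<and> measure p K \<le> measure q {y. \<exists>x\<in>K. x \<le> y}"
proof (cases "K = {}")
  case False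
  interpret p: prob_space p using p by (simp add: finite_moment_measures_def radon_prob_def)
  interpret q: prob_space q using q by (simp add: finite_moment_measures_def radon_prob_def)
  have sets: "sets p = sets borel" "sets q = sets borel"
    using p q by (auto simp: finite_moment_measures_def radon_prob_def)
  obtain \<phi> :: "'a \<Rightarrow> real" where \<phi>: "short \<phi>" "antimono \<phi>" "\<And>y. 0 \<le> \<phi> y"
    and \<phi>0: "\<And>y. \<phi> y = 0 \<longleftrightarrow> (\<exists>x\<in>K. x \<le> y)"
    by (rule L_ordered_upset_distance[OF L K False]) (rule that)
  have [measurable]: "\<phi> \<in> borel_measurable borel"
    using \<phi>(1) by (intro borel_measurable_continuous_onI short_continuous)
  have Kb[measurable]: "K \<in> sets borel" using K by (simp add: borel_compact)
  define U where "U n = {y. \<phi> y < 1 / real (Suc n)}" for n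
  have U[measurable]: "U n \<in> sets borel" for n
    unfolding U_def by measurable
  have bound: "measure p K \<le> measure q (U n)" for n
  proof -
    define c where "c = 1 / real (Suc n)"
    have "0 < c" by (simp add: c_def)
    \<comment> \<open>This short monotone function lies between \<open>c\<close> times the
      indicators of \<open>K\<close> and of \<open>U n\<close>, so comparing integrals and dividing
      by \<open>c\<close> gives the bound.\<close>
    define f where "f y = max 0 (c - \<phi> y)" for y
    have "short f"
      unfolding short_real_iff
    proof (intro allI)
      fix x y
      have "\<phi> y - \<phi> x \<le> dist x y" using \<phi>(1) by (metis short_real_iff dist_commute)
      then show "f x - f y \<le> dist x y"
        unfolding f_def max_def by (smt (verit) zero_le_dist)
    qed
    moreover have "mono f"
    proof (rule monoI)
      fix x y :: 'a assume "x \<le> y"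
      then have "\<phi> y \<le> \<phi> x" by (rule antimonoD[OF \<phi>(2)])
      then show "f x \<le> f y" by (simp add: f_def)
    qed
    ultimately have "(\<integral>x. f x \<partial>p) \<le> (\<integral>x. f x \<partial>q)"
      and int: "integrable p f" "integrable q f"
      using le p q by (auto simp: finite_moment_measures_def)
    moreover have "c * measure p K \<le> (\<integral>x. f x \<partial>p)"
    proof -
      have "(\<integral>x. c * indicator K x \<partial>p) \<le> (\<integral>x. f x \<partial>p)"
      proof (rule integral_mono)
        show "integrable p (\<lambda>x. c * indicator K x)"
          using Kb by (intro integrable_mult_right) (simp add: sets p.emeasure_eq_measure integrable_indicator_iff)
        fix x
        show "c * indicator K x \<le> f x"
          using \<phi>0[of x] by (auto simp: f_def indicator_def)
      qed (rule int)
      then show ?thesis using Kb by (simp add: sets)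
    qed
    moreover have "(\<integral>x. f x \<partial>q) \<le> c * measure q (U n)"
    proof -
      have "(\<integral>x. f x \<partial>q) \<le> (\<integral>x. c * indicator (U n) x \<partial>q)"
      proof (rule integral_mono)
        show "integrable q (\<lambda>x. c * indicator (U n) x)"
          using U by (intro integrable_mult_right) (simp add: sets q.emeasure_eq_measure integrable_indicator_iff)
        fix x
        show "f x \<le> c * indicator (U n) x"
          using \<phi>(3)[of x] \<open>0 < c\<close> by (auto simp: f_def U_def c_def indicator_def)
      qed (rule int)
      then show ?thesis using U by (simp add: sets)
    qed
    ultimately have "c * measure p K \<le> c * measure q (U n)" by linarith
    with \<open>0 < c\<close> show ?thesis by simp
  qed
  have "(\<Inter>n. U n) = {y. \<phi> y = 0}"
  proof safe
    fix y assume y: "y \<in> (\<Inter>n. U n)"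
    have "\<not> 0 < \<phi> y"
    proof
      assume "0 < \<phi> y"
      then obtain n where "1 / real (Suc n) < \<phi> y"
        by (rule nat_approx_posE)
      moreover have "y \<in> U n" using y by blast
      ultimately show False by (simp add: U_def)
    qed
    with \<phi>(3)[of y] show "\<phi> y = 0" by simp
  qed (simp add: U_def)
  then have Int: "(\<Inter>n. U n) = {y. \<exists>x\<in>K. x \<le> y}"
    by (simp add: \<phi>0)
  have "decseq U"
  proof (rule decseq_SucI)
    fix n
    have "1 / real (Suc (Suc n)) \<le> 1 / real (Suc n)" by (rule frac_le) auto
    then show "U (Suc n) \<subseteq> U n" unfolding U_def by fastforce
  qed
  then have "(\<lambda>n. measure q (U n)) \<longlonglongrightarrow> measure q (\<Inter>n. U n)"
    by (intro q.finite_Lim_measure_decseq) (auto simp: sets)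
  then have "measure p K \<le> measure q (\<Inter>n. U n)"
    by (rule LIMSEQ_le_const) (use bound in auto)
  moreover have "(\<Inter>n. U n) \<in> sets borel" by measurable
  ultimately show ?thesis by (simp add: Int)
qed simp

text \<open>Inner regularity reduces \<open>A\<close> to compact subsets. Nothing guarantees that
  the up-closure of \<open>A\<close> is Borel, hence the Borel superset \<open>B\<close>.\<close>

lemma measure_le_measure_superset_upset:
  fixes p q :: "'a::{metric_space, order} measure"
  assumes L: "L_ordered_metric_space TYPE('a)"
    and p: "p \<in> finite_moment_measures" and q: "q \<in> finite_moment_measures"
    and le: "\<And>f :: 'a \<Rightarrow> real. short f \<Longrightarrow> mono f \<Longrightarrow> (\<integral>x. f x \<partial>p) \<le> (\<integral>x. f x \<partial>q)"
    and A: "A \<in> sets borel" and B: "B \<in> sets borel" and AB: "{(x, y). x \<le> y} `` A \<subseteq> B"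
  shows "measure p A \<le> measure q B"
proof (rule field_le_epsilon)
  interpret q: prob_space q using q by (simp add: finite_moment_measures_def radon_prob_def)
  fix e :: real assume "0 < e"
  then obtain K where K: "compact K" "K \<subseteq> A" "measure p A < measure p K + e"
    using radon_prob_inner[OF _ A] p by (auto simp: finite_moment_measures_def)
  note * = measure_compact_le_measure_upset[OF L p q le K(1)]
  have "measure q {y. \<exists>x\<in>K. x \<le> y} \<le> measure q B"
    using K(2) AB B q by (intro q.finite_measure_mono) (auto simp: finite_moment_measures_def radon_prob_def)
  with * K(3) show "measure p A \<le> measure q B + e" by simp
qed

section \<open>Equivalence of the coupling order and the integral order\<close>

theorem theorem4p2p1:
  fixes p q :: "'a::{complete_space, order} measure"
  assumes "L_ordered_metric_space TYPE('a)"
    and "p \<in> finite_moment_measures" and "q \<in> finite_moment_measures"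
  shows "stochastic_le p q \<longleftrightarrow>
    (\<forall>f :: 'a \<Rightarrow> real. short f \<and> mono f \<longrightarrow> (\<integral>x. f x \<partial>p) \<le> (\<integral>x. f x \<partial>q))"
proof (intro iffI allI impI)
  have closed: "closed {(x :: 'a, y). x \<le> y}"
    using assms(1) unfolding L_ordered_metric_space_def ordered_metric_space_def by (rule conjunct1)
  have radon: "radon_prob p" "radon_prob q"
    using assms by (auto simp: finite_moment_measures_def)
  show "(\<integral>x. f x \<partial>p) \<le> (\<integral>x. f x \<partial>q)" if le: "stochastic_le p q" and f: "short f \<and> mono f" for f :: "'a \<Rightarrow> real"
  proof -
    obtain \<rho> where \<rho>: "coupling \<rho> p q" "emeasure \<rho> (- {(x, y). x \<le> y}) = 0"
      using le unfolding stochastic_le_def by blast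
    have sets: "sets \<rho> = sets borel" and pq: "p = distr \<rho> borel fst" "q = distr \<rho> borel snd"
      using \<rho> by (auto simp: coupling_def)
    have meas: "fst \<in> borel_measurable \<rho>" "snd \<in> borel_measurable \<rho>"
      unfolding measurable_cong_sets[OF sets refl]
      by (intro borel_measurable_continuous_onI continuous_on_fst continuous_on_snd continuous_on_id)+
    have fm: "f \<in> borel_measurable borel"
      using f by (intro borel_measurable_continuous_onI short_continuous) auto
    have int: "integrable p f" "integrable q f"
      using assms f by (auto simp: finite_moment_measures_def)
    have "- {(x :: 'a, y). x \<le> y} \<in> null_sets \<rho>"
      using \<rho>(2) closed by (auto simp: null_sets_def sets)
    \<comment> \<open>Off the null complement of the graph, monotonicity compares the two
      coordinates; integrating over the coupling compares the marginals.\<close>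
    then have "AE z in \<rho>. f (fst z) \<le> f (snd z)"
      by (rule AE_I') (use f in \<open>auto simp: mono_def\<close>)
    moreover have "integrable \<rho> (\<lambda>z. f (fst z))" "integrable \<rho> (\<lambda>z. f (snd z))"
      using int unfolding pq by (simp_all add: integrable_distr_eq[OF meas(1) fm] integrable_distr_eq[OF meas(2) fm])
    ultimately have "(\<integral>z. f (fst z) \<partial>\<rho>) \<le> (\<integral>z. f (snd z) \<partial>\<rho>)"
      by (intro integral_mono_AE)
    then show ?thesis
      unfolding pq by (simp add: integral_distr[OF meas(1) fm] integral_distr[OF meas(2) fm])
  qed
  assume le: "\<forall>f :: 'a \<Rightarrow> real. short f \<and> mono f \<longrightarrow> (\<integral>x. f x \<partial>p) \<le> (\<integral>x. f x \<partial>q)"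
  \<comment> \<open>The domination hypothesis for charges, with the graph of the order as
    \<open>R\<close>, is \<open>measure_le_measure_superset_upset\<close>.\<close>
  have "\<exists>r. charge_on {(x, y). x \<le> y} r \<and>
      (\<forall>A\<in>sets borel. r (A \<times> UNIV) = measure p A \<and> r (UNIV \<times> A) = measure q A)"
    using radon measure_le_measure_superset_upset[OF assms] le
    by (intro charge_on_marginals) (auto simp: radon_prob_def)
  then obtain r where "charge_on {(x, y). x \<le> y} r"
      "\<And>A. A \<in> sets borel \<Longrightarrow> r (A \<times> UNIV) = measure p A"
      "\<And>A. A \<in> sets borel \<Longrightarrow> r (UNIV \<times> A) = measure q A"
    by blast
  then interpret radon_charge p q "{(x, y). x \<le> y}" r
    using radon by unfold_locales
  show "stochastic_le p q"
    using coupling_exists[OF closed] unfolding stochastic_le_def .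
qed

end
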